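(* Assume (A1)–(A6) of the context. Then for all $j\ge0$ the value function does not increase pointwise: $$\forall x\in\mathcal{SS}^j,\qquad Q^j(x)\ge Q^{j+1}(x).$$
   Context: System and constraints. $x_{k+1}=Ax_k+Bu_k+w_k$, $x_k\in\mathbb R^{n_x}$, $u_k\in\mathbb R^{n_u}$, $A,B$ known; constraints $x_k\in\mathcal X=\{x: H_xx\le h_x\}$ (a polyhedron), $u_k\in\mathcal U=\{u: H_uu\le h_u\}$ (a nonempty polytope). Notation: $\mathcal S\ominus\mathcal Y=\{x\in\mathcal S: x+y\in\mathcal S\ \forall y\in\mathcal Y\}$, $\oplus$ is the Minkowski sum, $[\cdot]_i$ is the $i$-th column (or component). The control task is repeated in episodes $j=0,1,2,\dots$, each starting at $x_0^j=x_S$ and ending at a time $T^j$ with $x^j_{T^j}\in\mathcal O$. (A1) The $w_k$ are i.i.d., zero mean, with known distribution $p(w)$ and support $\mathcal W=\{w: H_ww\le h_w\}$, a nonempty polytope with the origin in its interior and vertices $v_1^{\mathcal W},\dots,v_{l_w}^{\mathcal W}$. (A2) $x_S\in\mathcal X$. (A3) $\mathcal O\subseteq\mathcal X$ is a polytope with nonempty relative interior and vertices $v_1^{\mathcal O},\dots,v_{l_{\mathcal O}}^{\mathcal O}$, and is robust positive invariant for $x_{k+1}=(A+BK)x_k+w_k$, $w_k\in\mathcal W$, where $K$ is a given gain with $A+BK$ stable (all eigenvalues in the open unit disc). Put $\mathcal{KO}=\{Kx: x\in\mathcal O\}$. (A4) The stage cost $\ell:\mathcal X\times\mathcal U\to\mathbb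 R$ is differentiable and jointly convex, $\ell(x,u)=0$ for all $x\in\mathcal O$, $u\in\mathcal{KO}$, and $\ell(x,u)>0$ for all $x\in\mathcal X\setminus\mathcal O$, $u\in\mathcal U\setminus\mathcal{KO}$. Discretized disturbances. $\tilde w_1,\dots,\tilde w_M\in\mathcal W$ are sample points including all vertices of $\mathcal W$. For each $w\in\mathcal W$ convex coefficients $\mu_m(w)\ge0$, $\sum_m\mu_m(w)=1$, with $w=\sum_{m=1}^M\mu_m(w)\tilde w_m$ are fixed, and $p_m=\mathbb E_w[\mu_m(w)]$. (A5) For each $w\in\mathcal W$ there is $\delta(w,M)>0$ with $\|w-\tilde w_m\|\le\delta(w,M)$ for every $m$ with $\mu_m(w)\ne0$; and if, starting from $M_1$ samples, further disturbances are sampled in $\mathcal W$ keeping the earlier ones, then there is $N>M_1$ such that $\delta(w,M_1)>\delta(w,M_2)$ for all $M_2\ge N$. Initialization. (A6) A sub-optimal (feasible) controller for the problem of minimizing $\mathbb E[\sum_{k\ge0}\ell(x_k,\pi(x_k))]$ over state feedback policies, subject to the dynamics from $x_S$ and the constraints for all disturbance realizations, is available and ends the episode in finite time. It is taken to be a tube controller: $\mathcal E$ is a polytopic robust positive invariant set for $x_{k+1}=(A+BK)x_k+w_k$, $w_k\in\mathcal W$; nominal sequences satisfy $\bar x_{k+1}=A\bar x_k+B\bar u_k$, $\bar x_0=x_S$, $\bar x_{k+1}\in\mathcal X\ominus\mathcal E$, $\bar u_k\in\mathcal U\ominus K\mathcal E$ for $0\le k\le T_0$, $\bar x_{T_0+1}\in\mathcal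 O\ominus\mathcal E$; $\pi_{\rm Tube}(x)=\bar u_k+K(x-\bar x_k)$ at time $k$; $\mathcal E_k=\bar x_k\oplus\mathcal E$, $0\le k\le T_0+1$. The columns of $\mathbf X^0$ are the vertices of $\mathcal O$ and of $\mathcal E_0,\dots,\mathcal E_{T_0+1}$. The columns of $\mathbf U^0$ are the corresponding inputs: $\pi_{\rm Tube}(v)$ for a vertex $v$ of $\mathcal E_k$, $k\le T_0$, and $Kv$ for vertices of $\mathcal O$ and $\mathcal E_{T_0+1}\subseteq\mathcal O$. The entries of the row vector $\mathbf J^0$ are $0$ for vertices of $\mathcal O$ and $J_k^0$ for vertices of $\mathcal E_k$, where $J^0_{T_0+1}=0$ and $J_k^0=\max_{x\in\mathcal E_k}\ell(x,\pi_{\rm Tube}(x))+J_{k+1}^0$. Safe set and value function. For $j\ge0$, $\mathcal{SS}^j$ is the convex hull of the columns of $\mathbf X^j$, and for $x\in\mathcal{SS}^j$ $$Q^j(x)=\min_{\lambda}\{\mathbf J^j\lambda:\ \mathbf X^j\lambda=x,\ \lambda\ge0,\ \mathbf 1^\top\lambda=1\}.$$ MPC. For $j\ge1$, $$\hat V^j(x)=\min_u\ \ell(x,u)+\sum_{m=1}^Mp_mQ^{j-1}(Ax+Bu+\tilde w_m)\quad\text{s.t. }x\in\mathcal X,\ u\in\mathcal U,\ Ax+Bu\in\mathcal{SS}^{j-1}\ominus\mathcal W,$$ and $\pi^{j\star}(x)$ denotes an optimal input; in episode $j$ the input $u_k^j=\pi^{j\star}(x_k^j)$ is applied. Data update after episode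 $j\ge1$. For each $k=0,\dots,T^j$ exploration yields states $x_1^{\mathcal W\star},\dots,x_{l_w}^{\mathcal W\star}$ (depending on $k,j$), as follows. Write $\mathcal{SS}^{j-1}\ominus\mathcal W=\{x: Hx\le h\}$, let $f_k^j(u)=\ell(x_k^j,u)+\sum_mp_mQ^{j-1}(Ax_k^j+Bu+\tilde w_m)$, let $u^\star=\pi^{j\star}(x_k^j)$, and let $\nu,\gamma\ge0$ be optimal multipliers of $H(Ax_k^j+Bu)\le h$ and $H_uu\le h_u$. If $\nu\neq0$, maximize $\nu^\top HBd$ over $d\in\mathbb R^{n_u}$ and $u_1^{\mathcal W},\dots,u_{l_w}^{\mathcal W}$ subject to $\nabla f_k^j(u^\star)^\top d\le0$, $Ax_k^j+B(u^\star+d)\in\mathcal X\ominus\mathcal W$, $u^\star+d\in\mathcal U$, and, for all $i$, $x_i^{\mathcal W}=Ax_k^j+B(u^\star+d)+v_i^{\mathcal W}$, $Ax_i^{\mathcal W}+Bu_i^{\mathcal W}\in\mathcal{SS}^{j-1}\ominus\mathcal W$, $u_i^{\mathcal W}\in\mathcal U$; the $x_i^{\mathcal W\star}$ are the optimal $x_i^{\mathcal W}$. If $\nu=0$, the $x_i^{\mathcal W\star}$ are sampled from a Gaussian with mean $x_k^j$ and identity covariance truncated to $\mathcal{SS}^{j-1}$. Then $\mathbf X^j$ is $\mathbf X^{j-1}$ with the columns $x_0^j,\dots,x_{T^j}^j$ and all explored states appended; $\mathbf U^j$ and $\mathbf J^j$ are $\mathbf U^{j-1}$ and $\mathbf J^{j-1}$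 with $\pi^{j\star}(x)$ and $\hat V^j(x)$ appended for each appended state $x$. *)

theory Defs
  imports "HOL-Probability.Probability"
begin

(* Unlike the usual Pontryagin difference, the result is a subset of S by definition. *)
definition set_erosion :: "'a::plus set \<Rightarrow> 'a set \<Rightarrow> 'a set" (infixl \<open>\<ominus>\<close> 65) where
  "S \<ominus> Y = {x \<in> S. \<forall>y\<in>Y. x + y \<in> S}"

definition robust_positive_invariant ::
  "real^'n^'n \<Rightarrow> (real^'n) set \<Rightarrow> (real^'n) set \<Rightarrow> bool" where
  "robust_positive_invariant F W S \<longleftrightarrow> (\<forall>x\<in>S. \<forall>w\<in>W. F *v x + w \<in> S)"

definition schur_stable :: "real^'n^'n \<Rightarrow> bool" where
  "schur_stable F \<longleftrightarrow>
     (\<forall>(z::complex) v. v \<noteq> 0 \<and> map_matrix complex_of_real F *v v = z *s v \<longrightarrow> cmod z < 1)"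

definition measure_support :: "'a::topological_space measure \<Rightarrow> 'a set" where
  "measure_support P = {x. \<forall>V. open V \<longrightarrow> x \<in> V \<longrightarrow> 0 < emeasure P V}"

definition enumerates_vertices :: "'a::real_vector list \<Rightarrow> 'a set \<Rightarrow> bool" where
  "enumerates_vertices vs S \<longleftrightarrow> distinct vs \<and> set vs = {v. v extreme_point_of S}"

definition gaussian :: "real^'n \<Rightarrow> (real^'n) measure" where
  "gaussian m = density lborel (\<lambda>x. ennreal (\<Prod>i\<in>UNIV. normal_density (m $ i) 1 (x $ i)))"

definition truncated_gaussian :: "real^'n \<Rightarrow> (real^'n) set \<Rightarrow> (real^'n) measure" where
  "truncated_gaussian m S = uniform_measure (gaussian m) S"

(* The mean and the truncation set of a sample depend on the past of the run.  Sampling is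
   therefore a function of mean, set and a random seed with law R: for every fixed mean and set
   the outcome has the truncated Gaussian law.  A fresh seed, independent of everything
   else, is used for each sample. *)
definition truncated_gaussian_sampler ::
  "(real^'n) measure \<Rightarrow> (real^'n \<Rightarrow> (real^'n) set \<Rightarrow> real^'n \<Rightarrow> real^'n) \<Rightarrow> bool" where
  "truncated_gaussian_sampler R draw \<longleftrightarrow>
     (\<forall>m S. compact S \<and> convex S \<and> interior S \<noteq> {} \<longrightarrow>
        draw m S \<in> borel_measurable R \<and>
        distr R borel (draw m S) = truncated_gaussian m S \<and>
        (\<forall>r. draw m S r \<in> S))"

definition tube_policy ::
  "real^'n^'m \<Rightarrow> (nat \<Rightarrow> real^'n) \<Rightarrow> (nat \<Rightarrow> real^'m) \<Rightarrow> nat \<Rightarrow> real^'n \<Rightarrow> real^'m" where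
  "tube_policy K xbar ubar k x = ubar k + K *v (x - xbar k)"

definition tube_section :: "(nat \<Rightarrow> real^'n) \<Rightarrow> (real^'n) set \<Rightarrow> nat \<Rightarrow> (real^'n) set" where
  "tube_section xbar E k = (\<lambda>e. xbar k + e) ` E"

(* Lists hold the columns of the data matrices. *)
definition safe_set :: "(real^'n) list \<Rightarrow> (real^'n) set" where
  "safe_set Xs = convex hull (set Xs)"

definition simplex_coeffs :: "(real^'n) list \<Rightarrow> real^'n \<Rightarrow> (nat \<Rightarrow> real) set" where
  "simplex_coeffs Xs x = {lam. (\<forall>i<length Xs. 0 \<le> lam i) \<and> (\<Sum>i<length Xs. lam i) = 1 \<and>
     (\<Sum>i<length Xs. lam i *\<^sub>R (Xs ! i)) = x}"

definition value_fun :: "(real^'n) list \<Rightarrow> real list \<Rightarrow> real^'n \<Rightarrow> real" where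
  "value_fun Xs Js x =
     (LEAST q. q \<in> (\<lambda>lam. \<Sum>i<length Xs. Js ! i * lam i) ` simplex_coeffs Xs x)"

definition mpc_inputs ::
  "real^'n^'n \<Rightarrow> real^'m^'n \<Rightarrow> (real^'n) set \<Rightarrow> (real^'m) set \<Rightarrow> (real^'n) set \<Rightarrow> (real^'n) set
   \<Rightarrow> real^'n \<Rightarrow> (real^'m) set" where
  "mpc_inputs A B XX UU W S x = {u. x \<in> XX \<and> u \<in> UU \<and> A *v x + B *v u \<in> S \<ominus> W}"

definition mpc_cost ::
  "real^'n^'n \<Rightarrow> real^'m^'n \<Rightarrow> (real^'n \<Rightarrow> real^'m \<Rightarrow> real) \<Rightarrow> nat \<Rightarrow> (nat \<Rightarrow> real)
   \<Rightarrow> (nat \<Rightarrow> real^'n) \<Rightarrow> (real^'n \<Rightarrow> real) \<Rightarrow> real^'n \<Rightarrow> real^'m \<Rightarrow> real" where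
  "mpc_cost A B ell Ms p wt Q x u =
     ell x u + (\<Sum>m=1..Ms. p m * Q (A *v x + B *v u + wt m))"

definition mpc_value ::
  "real^'n^'n \<Rightarrow> real^'m^'n \<Rightarrow> (real^'n) set \<Rightarrow> (real^'m) set \<Rightarrow> (real^'n) set
   \<Rightarrow> (real^'n \<Rightarrow> real^'m \<Rightarrow> real) \<Rightarrow> nat \<Rightarrow> (nat \<Rightarrow> real) \<Rightarrow> (nat \<Rightarrow> real^'n)
   \<Rightarrow> (real^'n) set \<Rightarrow> (real^'n \<Rightarrow> real) \<Rightarrow> real^'n \<Rightarrow> real" where
  "mpc_value A B XX UU W ell Ms p wt S Q x =
     (LEAST c. c \<in> mpc_cost A B ell Ms p wt Q x ` mpc_inputs A B XX UU W S x)"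

definition mpc_policy ::
  "real^'n^'n \<Rightarrow> real^'m^'n \<Rightarrow> (real^'n) set \<Rightarrow> (real^'m) set \<Rightarrow> (real^'n) set
   \<Rightarrow> (real^'n \<Rightarrow> real^'m \<Rightarrow> real) \<Rightarrow> nat \<Rightarrow> (nat \<Rightarrow> real) \<Rightarrow> (nat \<Rightarrow> real^'n)
   \<Rightarrow> (real^'n) set \<Rightarrow> (real^'n \<Rightarrow> real) \<Rightarrow> (real^'n \<Rightarrow> real^'m) \<Rightarrow> bool" where
  "mpc_policy A B XX UU W ell Ms p wt S Q pol \<longleftrightarrow>
     (\<forall>x. mpc_inputs A B XX UU W S x \<noteq> {} \<longrightarrow>
        is_arg_min (mpc_cost A B ell Ms p wt Q x) (\<lambda>u. u \<in> mpc_inputs A B XX UU W S x) (pol x))"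

(* The MPC objective is only defined on the feasible inputs D, and an optimal input may lie on
   the boundary of D, so derivatives are taken within D.  Since the value function is only
   piecewise affine, the objective may have kinks; there any subgradient is admitted. *)
definition gradient_within ::
  "(real^'m \<Rightarrow> real) \<Rightarrow> (real^'m) set \<Rightarrow> real^'m \<Rightarrow> real^'m \<Rightarrow> bool" where
  "gradient_within f D u g \<longleftrightarrow>
     (if f differentiable (at u within D)
      then (f has_derivative (\<lambda>d. g \<bullet> d)) (at u within D)
      else (\<forall>v\<in>D. f u + g \<bullet> (v - u) \<le> f v))"

(* Karush-Kuhn-Tucker conditions for the n constraints H r \<bullet> (y + B *v u) \<le> h r (r < n) with
   multipliers nu, and the constraints Hu *v u \<le> hu with multipliers gam. *)
definition optimal_multipliers ::
  "real^'m^'n \<Rightarrow> nat \<Rightarrow> (nat \<Rightarrow> real^'n) \<Rightarrow> (nat \<Rightarrow> real) \<Rightarrow> real^'m^'c \<Rightarrow> real^'c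
   \<Rightarrow> real^'n \<Rightarrow> real^'m \<Rightarrow> real^'m \<Rightarrow> (nat \<Rightarrow> real) \<Rightarrow> real^'c \<Rightarrow> bool" where
  "optimal_multipliers B n H h Hu hu y u g nu gam \<longleftrightarrow>
     (\<forall>r<n. 0 \<le> nu r) \<and> (\<forall>c. 0 \<le> gam $ c) \<and>
     g + (\<Sum>r<n. nu r *\<^sub>R (transpose B *v H r)) + transpose Hu *v gam = 0 \<and>
     (\<forall>r<n. nu r * (H r \<bullet> (y + B *v u) - h r) = 0) \<and>
     (\<forall>c. gam $ c * ((Hu *v u) $ c - hu $ c) = 0)"

definition exploration_feasible ::
  "real^'n^'n \<Rightarrow> real^'m^'n \<Rightarrow> (real^'n) set \<Rightarrow> (real^'m) set \<Rightarrow> (real^'n) set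
   \<Rightarrow> (real^'n) list \<Rightarrow> (real^'n) set \<Rightarrow> real^'n \<Rightarrow> real^'m \<Rightarrow> real^'m
   \<Rightarrow> ((real^'m) \<times> (nat \<Rightarrow> real^'m)) set" where
  "exploration_feasible A B XX UU W vW S x us g =
     {(d, uW). g \<bullet> d \<le> 0 \<and>
        A *v x + B *v (us + d) \<in> XX \<ominus> W \<and> us + d \<in> UU \<and>
        (\<forall>i<length vW. A *v (A *v x + B *v (us + d) + vW ! i) + B *v uW i \<in> S \<ominus> W \<and>
           uW i \<in> UU)}"

definition exploration_step ::
  "real^'n^'n \<Rightarrow> real^'m^'n \<Rightarrow> (real^'n) set \<Rightarrow> (real^'m) set \<Rightarrow> (real^'n) set
   \<Rightarrow> real^'m^'c \<Rightarrow> real^'c \<Rightarrow> (real^'n) list \<Rightarrow> (real^'n) set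
   \<Rightarrow> nat \<Rightarrow> (nat \<Rightarrow> real^'n) \<Rightarrow> (nat \<Rightarrow> real) \<Rightarrow> (real^'m \<Rightarrow> real)
   \<Rightarrow> real^'n \<Rightarrow> real^'m \<Rightarrow> (nat \<Rightarrow> real^'n) \<Rightarrow> (nat \<Rightarrow> real^'n) \<Rightarrow> bool" where
  "exploration_step A B XX UU W Hu hu vW S n H h f x us smp xW \<longleftrightarrow>
     (\<exists>g nu gam.
        gradient_within f (mpc_inputs A B XX UU W S x) us g \<and>
        optimal_multipliers B n H h Hu hu (A *v x) us g nu gam \<and>
        (if \<exists>r<n. nu r \<noteq> 0
         then \<exists>d uW.
                is_arg_max (\<lambda>(d, uW). \<Sum>r<n. nu r * (H r \<bullet> (B *v d)))
                  (\<lambda>z. z \<in> exploration_feasible A B XX UU W vW S x us g) (d, uW) \<and>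
                (\<forall>i<length vW. xW i = A *v x + B *v (us + d) + vW ! i)
         else \<forall>i<length vW. xW i = smp i))"

end

theory Submission
  imports Defs
begin

text \<open>Every new data pair is appended, never replaced.  A convex combination of the old columns,
  padded with zero coefficients, is therefore admissible for the enlarged data at the same cost,
  so the later minimum ranges over a larger set.  Both minima are attained because the graph of
  attainable costs is the convex hull of finitely many points.\<close>

text \<open>Weights are attached to indices rather than to points because \<open>f\<close> need not
  be injective: data columns may repeat, and a repeated state may carry different costs. This
  matches the indexing in \<open>simplex_coeffs\<close>.\<close>

lemma convex_hull_finite_image:
  assumes "finite I"
  shows "convex hull (f ` I) =
    {\<Sum>i\<in>I. c i *\<^sub>R f i | c. (\<forall>i\<in>I. 0 \<le> c i) \<and> sum c I = (1::real)}"
proof -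
  \<comment> \<open>As a union of singletons indexed by \<open>I\<close>, the image falls under
    \<open>convex_hull_finite_union\<close>, where the point \<open>s i\<close> chosen from the
    \<open>i\<close>-th set can only be \<open>f i\<close>.\<close>
  have "f ` I = \<Union>((\<lambda>i. {f i}) ` I)" by auto
  then have "convex hull (f ` I) = {\<Sum>i\<in>I. c i *\<^sub>R s i | c s.
      (\<forall>i\<in>I. 0 \<le> c i) \<and> sum c I = 1 \<and> (\<forall>i\<in>I. s i \<in> {f i})}"
    using convex_hull_finite_union[OF assms, of "\<lambda>i. {f i}"] by simp
  also have "\<dots> = {\<Sum>i\<in>I. c i *\<^sub>R f i | c. (\<forall>i\<in>I. 0 \<le> c i) \<and> sum c I = 1}"
  proof (intro Collect_cong iffI; elim exE conjE)
    fix z c s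
    assume *: "z = (\<Sum>i\<in>I. c i *\<^sub>R s i)" "\<forall>i\<in>I. 0 \<le> c i" "sum c I = 1" "\<forall>i\<in>I. s i \<in> {f i}"
    then have "z = (\<Sum>i\<in>I. c i *\<^sub>R f i)" by simp
    with * show "\<exists>c. z = (\<Sum>i\<in>I. c i *\<^sub>R f i) \<and> (\<forall>i\<in>I. 0 \<le> c i) \<and> sum c I = 1"
      by blast
  qed blast
  finally show ?thesis .
qed

lemma simplex_coeffs_nonempty:
  assumes "y \<in> safe_set Xs"
  shows "simplex_coeffs Xs y \<noteq> {}"
proof -
  have "set Xs = (!) Xs ` {..<length Xs}"
    by (auto simp: set_conv_nth)
  with assms have "y \<in> convex hull ((!) Xs ` {..<length Xs})"
    by (simp add: safe_set_def)
  then show ?thesis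
    by (auto simp: convex_hull_finite_image simplex_coeffs_def)
qed

text \<open>Compactness cannot be pulled from \<open>simplex_coeffs\<close> directly: its members
  are functions on all naturals, unconstrained from \<open>length Xs\<close> on. Instead the costs
  are read off a compact set in the finite-dimensional space of (state, cost) pairs.\<close>

lemma compact_attainable_costs:
  "compact ((\<lambda>lam. \<Sum>i<length Xs. Js ! i * lam i) ` simplex_coeffs Xs y)"
proof -
  define G where "G = convex hull ((\<lambda>i. (Xs ! i, Js ! i)) ` {..<length Xs})"
  \<comment> \<open>\<open>G\<close> is the hull of finitely many points, and the fibre over
    \<open>y\<close> cuts it with a closed set; projecting to the cost coordinate preserves
    compactness.\<close>
  have "compact (G \<inter> {y} \<times> UNIV)"
    by (auto simp: G_def intro!: finite_imp_compact_convex_hull closed_Times)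
  then have "compact (snd ` (G \<inter> {y} \<times> UNIV))"
    by (intro compact_continuous_image continuous_on_snd continuous_on_id)
  also have "snd ` (G \<inter> {y} \<times> UNIV)
      = (\<lambda>lam. \<Sum>i<length Xs. Js ! i * lam i) ` simplex_coeffs Xs y" (is "?L = ?R")
  proof -
    \<comment> \<open>For one weight vector, the first component is the state constraint of
      \<open>simplex_coeffs\<close> and the second is the objective of
      \<open>value_fun\<close>.\<close>
    have pair: "(\<Sum>i<length Xs. c i *\<^sub>R (Xs ! i, Js ! i))
        = (\<Sum>i<length Xs. c i *\<^sub>R (Xs ! i), \<Sum>i<length Xs. Js ! i * c i)" for c
      by (simp add: sum_prod mult.commute)
    have "q \<in> ?L \<longleftrightarrow> (y, q) \<in> G" for q
      by (auto simp: image_iff intro!: bexI[of _ "(y, q)"])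
    also have "(y, q) \<in> G \<longleftrightarrow> q \<in> ?R" for q
      unfolding G_def convex_hull_finite_image[OF finite_lessThan] pair
      by (auto simp: simplex_coeffs_def image_iff)
    finally show ?thesis by blast
  qed
  finally show ?thesis .
qed

text \<open>\<open>LEAST\<close> denotes a minimum only if one is attained. A nonempty compact set
  of reals contains its infimum, which justifies reading \<open>value_fun\<close> as a
  minimum.\<close>

lemma value_fun_is_minimum:
  fixes Js :: "real list"
  assumes "simplex_coeffs Xs y \<noteq> {}"
  defines "C \<equiv> (\<lambda>lam. \<Sum>i<length Xs. Js ! i * lam i) ` simplex_coeffs Xs y"
  shows "value_fun Xs Js y \<in> C" "\<And>q. q \<in> C \<Longrightarrow> value_fun Xs Js y \<le> q"
proof -
  have "compact C" "C \<noteq> {}"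
    using assms compact_attainable_costs by auto
  then obtain m where m: "m \<in> C" "\<forall>q\<in>C. m \<le> q"
    using compact_attains_inf by blast
  then have "value_fun Xs Js y = m"
    unfolding value_fun_def C_def by (intro Least_equality) auto
  with m show "value_fun Xs Js y \<in> C" "\<And>q. q \<in> C \<Longrightarrow> value_fun Xs Js y \<le> q"
    by auto
qed

lemma value_fun_append_le:
  assumes "length Js = length Xs" "y \<in> safe_set Xs"
  shows "value_fun (Xs @ Ys) (Js @ Ks) y \<le> value_fun Xs Js y"
proof -
  obtain lam where lam: "lam \<in> simplex_coeffs Xs y"
    and val: "value_fun Xs Js y = (\<Sum>i<length Xs. Js ! i * lam i)"
    using value_fun_is_minimum(1)[OF simplex_coeffs_nonempty[OF assms(2)], of Js] by auto
  \<comment> \<open>The truncation matters: membership of \<open>lam\<close> in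
    \<open>simplex_coeffs\<close> says nothing about its values at the indices of the new
    columns.\<close>
  define lam' where "lam' i = (if i < length Xs then lam i else 0)" for i
  \<comment> \<open>The codomain is left polymorphic because the fact serves both real sums
    (weights, costs) and vector sums (states).\<close>
  have restrict: "(\<Sum>i<length (Xs @ Ys). f i) = (\<Sum>i<length Xs. f i)"
    if "\<And>i. \<not> i < length Xs \<Longrightarrow> f i = 0" for f :: "nat \<Rightarrow> 'b::comm_monoid_add"
    using that by (intro sum.mono_neutral_right) auto
  have "lam' \<in> simplex_coeffs (Xs @ Ys) y"
  proof -
    have "(\<Sum>i<length (Xs @ Ys). lam' i) = (\<Sum>i<length Xs. lam' i)"
      by (rule restrict) (simp add: lam'_def)
    moreover have "(\<Sum>i<length (Xs @ Ys). lam' i *\<^sub>R ((Xs @ Ys) ! i))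
        = (\<Sum>i<length Xs. lam' i *\<^sub>R ((Xs @ Ys) ! i))"
      by (rule restrict) (simp add: lam'_def)
    ultimately show ?thesis
      using lam by (simp add: simplex_coeffs_def lam'_def nth_append)
  qed
  moreover have "(\<Sum>i<length (Xs @ Ys). (Js @ Ks) ! i * lam' i) = value_fun Xs Js y"
  proof -
    have "(\<Sum>i<length (Xs @ Ys). (Js @ Ks) ! i * lam' i)
        = (\<Sum>i<length Xs. (Js @ Ks) ! i * lam' i)"
      by (rule restrict) (simp add: lam'_def)
    \<comment> \<open>Equal lengths make \<open>Js @ Ks\<close> agree with \<open>Js\<close> at
      every index below \<open>length Xs\<close>, so each old column keeps its own cost.\<close>
    then show ?thesis
      using assms(1) by (simp add: val lam'_def nth_append)
  qed
  \<comment> \<open>\<open>lam'\<close> plays two roles: it shows that the enlarged problem is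
    feasible, so its minimum exists, and it attains the old value there.\<close>
  ultimately show ?thesis
    using value_fun_is_minimum(2)[of "Xs @ Ys" y "value_fun Xs Js y" "Js @ Ks"]
    by (metis (no_types, lifting) empty_iff image_eqI)
qed

theorem proposition4:
  fixes A :: "real^'nx^'nx" and B :: "real^'nu^'nx" and K :: "real^'nx^'nu"
    and Hx :: "real^'nx^'cx" and hx :: "real^'cx"
    and Hu :: "real^'nu^'cu" and hu :: "real^'cu"
    and Hw :: "real^'nx^'cw" and hw :: "real^'cw"
    and XX W OS E :: "(real^'nx) set" and UU :: "(real^'nu) set"
    and Om :: "'o measure" and P R :: "(real^'nx) measure"
    and w :: "nat \<Rightarrow> nat \<Rightarrow> 'o \<Rightarrow> real^'nx"
    and seed :: "nat \<Rightarrow> nat \<Rightarrow> nat \<Rightarrow> 'o \<Rightarrow> real^'nx"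
    and draw :: "real^'nx \<Rightarrow> (real^'nx) set \<Rightarrow> real^'nx \<Rightarrow> real^'nx"
    and \<omega> :: 'o
    and vW vO :: "(real^'nx) list" and vE :: "nat \<Rightarrow> (real^'nx) list"
    and xS :: "real^'nx" and ell :: "real^'nx \<Rightarrow> real^'nu \<Rightarrow> real"
    and Ms :: nat and wt :: "nat \<Rightarrow> real^'nx" and mu :: "nat \<Rightarrow> nat \<Rightarrow> real^'nx \<Rightarrow> real"
    and p :: "nat \<Rightarrow> real" and \<delta> :: "real^'nx \<Rightarrow> nat \<Rightarrow> real"
    and T0 :: nat and xbar :: "nat \<Rightarrow> real^'nx" and ubar :: "nat \<Rightarrow> real^'nu"
    and J0 :: "nat \<Rightarrow> real"
    and X :: "nat \<Rightarrow> (real^'nx) list" and U :: "nat \<Rightarrow> (real^'nu) list" and J :: "nat \<Rightarrow> real list"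
    and pol :: "nat \<Rightarrow> real^'nx \<Rightarrow> real^'nu" and T :: "nat \<Rightarrow> nat"
    and x :: "nat \<Rightarrow> nat \<Rightarrow> real^'nx" and u :: "nat \<Rightarrow> nat \<Rightarrow> real^'nu"
    and nH :: "nat \<Rightarrow> nat" and H :: "nat \<Rightarrow> nat \<Rightarrow> real^'nx" and h :: "nat \<Rightarrow> nat \<Rightarrow> real"
    and xW :: "nat \<Rightarrow> nat \<Rightarrow> nat \<Rightarrow> real^'nx" and new :: "nat \<Rightarrow> (real^'nx) list"
  assumes state_constraints: "XX = {y. Hx *v y \<le> hx}"
    and input_constraints: "UU = {v. Hu *v v \<le> hu}" "polytope UU" "UU \<noteq> {}"
    and disturbance_set: "W = {y. Hw *v y \<le> hw}" "polytope W" "0 \<in> interior W"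
      "enumerates_vertices vW W"
    and prob: "prob_space Om" "\<And>j k. distr Om borel (w j k) = P"
      "\<And>j k i. distr Om borel (seed j k i) = R"
      "prob_space.indep_vars Om (\<lambda>_. borel)
         (case_sum (\<lambda>(j, k). w j k) (\<lambda>(j, k, i). seed j k i)) UNIV"
      "(LINT y|P. y) = 0" "measure_support P = W"
    and sampler: "truncated_gaussian_sampler R draw"
    and start: "xS \<in> XX"
    and target: "OS \<subseteq> XX" "polytope OS" "rel_interior OS \<noteq> {}" "enumerates_vertices vO OS"
      "robust_positive_invariant (A + B ** K) W OS" "schur_stable (A + B ** K)"
    and cost: "(\<lambda>(y, v). ell y v) differentiable_on (XX \<times> UU)"
      "convex_on (XX \<times> UU) (\<lambda>(y, v). ell y v)"
      "\<And>y v. y \<in> OS \<Longrightarrow> v \<in> (\<lambda>z. K *v z) ` OS \<Longrightarrow> ell y v = 0"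
      "\<And>y v. y \<in> XX - OS \<Longrightarrow> v \<in> UU - (\<lambda>z. K *v z) ` OS \<Longrightarrow> ell y v > 0"
    and samples: "\<And>m. 1 \<le> m \<Longrightarrow> wt m \<in> W" "set vW \<subseteq> wt ` {1..Ms}"
    and coefficients:
      "\<And>N m y. Ms \<le> N \<Longrightarrow> m \<in> {1..N} \<Longrightarrow> y \<in> W \<Longrightarrow> mu N m y \<ge> 0"
      "\<And>N y. Ms \<le> N \<Longrightarrow> y \<in> W \<Longrightarrow> (\<Sum>m=1..N. mu N m y) = 1"
      "\<And>N y. Ms \<le> N \<Longrightarrow> y \<in> W \<Longrightarrow> y = (\<Sum>m=1..N. mu N m y *\<^sub>R wt m)"
    and probabilities: "\<And>m. m \<in> {1..Ms} \<Longrightarrow> set_integrable P W (mu Ms m)"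
      "\<And>m. m \<in> {1..Ms} \<Longrightarrow> p m = (LINT y:W|P. mu Ms m y)"
    and discretization:
      "\<And>N y. Ms \<le> N \<Longrightarrow> y \<in> W \<Longrightarrow> \<delta> y N > 0"
      "\<And>N m y. Ms \<le> N \<Longrightarrow> y \<in> W \<Longrightarrow> m \<in> {1..N} \<Longrightarrow> mu N m y \<noteq> 0 \<Longrightarrow> norm (y - wt m) \<le> \<delta> y N"
      "\<And>M1 y. Ms \<le> M1 \<Longrightarrow> y \<in> W \<Longrightarrow> \<exists>N>M1. \<forall>M2\<ge>N. \<delta> y M1 > \<delta> y M2"
    and tube: "polytope E" "E \<noteq> {}" "robust_positive_invariant (A + B ** K) W E"
      "xbar 0 = xS"
      "\<And>k. k \<le> T0 \<Longrightarrow> xbar (Suc k) = A *v xbar k + B *v ubar k"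
      "\<And>k. k \<le> T0 \<Longrightarrow> xbar (Suc k) \<in> XX \<ominus> E"
      "\<And>k. k \<le> T0 \<Longrightarrow> ubar k \<in> UU \<ominus> ((\<lambda>e. K *v e) ` E)"
      "xbar (Suc T0) \<in> OS \<ominus> E"
      "\<And>k. k \<le> Suc T0 \<Longrightarrow> enumerates_vertices (vE k) (tube_section xbar E k)"
    and initial_costs: "J0 (Suc T0) = 0"
      "\<And>k. k \<le> T0 \<Longrightarrow> J0 k =
         (GREATEST c. c \<in> (\<lambda>y. ell y (tube_policy K xbar ubar k y)) ` tube_section xbar E k)
         + J0 (Suc k)"
    and initial_data:
      "X 0 = vO @ concat (map vE [0..<Suc (Suc T0)])"
      "U 0 = map (\<lambda>v. K *v v) vO
             @ concat (map (\<lambda>k. map (tube_policy K xbar ubar k) (vE k)) [0..<Suc T0])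
             @ map (\<lambda>v. K *v v) (vE (Suc T0))"
      "J 0 = map (\<lambda>_. 0) vO @ concat (map (\<lambda>k. map (\<lambda>_. J0 k) (vE k)) [0..<Suc (Suc T0)])"
    and policy: "\<And>j. 1 \<le> j \<Longrightarrow>
        mpc_policy A B XX UU W ell Ms p wt (safe_set (X (j - 1))) (value_fun (X (j - 1)) (J (j - 1)))
          (pol j)"
    and outcome: "\<omega> \<in> space Om" "\<And>j k. w j k \<omega> \<in> W"
    and episodes: "\<And>j. x j 0 = xS"
      "\<And>j k. k < T j \<Longrightarrow> x j (Suc k) = A *v x j k + B *v u j k + w j k \<omega>"
      "\<And>j. x j (T j) \<in> OS"
      "T 0 \<le> Suc T0"
      "\<And>k. k < T 0 \<Longrightarrow> u 0 k = tube_policy K xbar ubar k (x 0 k)"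
      "\<And>j k. 1 \<le> j \<Longrightarrow> k < T j \<Longrightarrow> u j k = pol j (x j k)"
    and halfspaces: "\<And>j. 1 \<le> j \<Longrightarrow>
        safe_set (X (j - 1)) \<ominus> W = {y. \<forall>r<nH j. H j r \<bullet> y \<le> h j r}"
    and exploration: "\<And>j k. 1 \<le> j \<Longrightarrow> k \<le> T j \<Longrightarrow>
        exploration_step A B XX UU W Hu hu vW (safe_set (X (j - 1))) (nH j) (H j) (h j)
          (mpc_cost A B ell Ms p wt (value_fun (X (j - 1)) (J (j - 1))) (x j k))
          (x j k) (pol j (x j k))
          (\<lambda>i. draw (x j k) (safe_set (X (j - 1))) (seed j k i \<omega>)) (xW j k)"
    and appended: "\<And>j. 1 \<le> j \<Longrightarrow> new j = map (x j) [0..<Suc (T j)]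
        @ concat (map (\<lambda>k. map (xW j k) [0..<length vW]) [0..<Suc (T j)])"
    and update:
      "\<And>j. 1 \<le> j \<Longrightarrow> X j = X (j - 1) @ new j"
      "\<And>j. 1 \<le> j \<Longrightarrow> U j = U (j - 1) @ map (pol j) (new j)"
      "\<And>j. 1 \<le> j \<Longrightarrow> J j = J (j - 1) @
         map (mpc_value A B XX UU W ell Ms p wt (safe_set (X (j - 1)))
                (value_fun (X (j - 1)) (J (j - 1)))) (new j)"
  shows "\<forall>j. \<forall>y \<in> safe_set (X j). value_fun (X j) (J j) y \<ge> value_fun (X (Suc j)) (J (Suc j)) y"
proof (intro allI ballI)
  fix j y
  assume y: "y \<in> safe_set (X j)"
  \<comment> \<open>States and costs stay aligned: initially each vertex list is paired with a cost
    list mapped from it, and each update appends one cost per new state.\<close>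
  have length_eq: "length (J i) = length (X i)" for i
  proof (induction i)
    case 0
    show ?case
      unfolding initial_data by (simp add: length_concat comp_def)
  next
    case (Suc i)
    then show ?case
      using update(1,3)[of "Suc i"] by simp
  qed
  \<comment> \<open>The update rules are taken at \<open>Suc j\<close>, where the index condition
    holds even for \<open>j = 0\<close> and the predecessor is \<open>j\<close>.\<close>
  show "value_fun (X (Suc j)) (J (Suc j)) y \<le> value_fun (X j) (J j) y"
    using value_fun_append_le[OF length_eq y] update(1,3)[of "Suc j"] by simp
qed

end
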